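(* Let $\delta,k$ be integers with $0<\delta\le k-3$, let $V=\{1,\dots,n\}$ with $n=2k+\delta$, and let $\mathcal K\subseteq 2^V$ be a $(k+\delta-1)$-uniform hypergraph satisfying (K1) $|K\cap K'|\ge\delta$ for all $K,K'\in\mathcal K$; (K2) $|K\cap K'|\le k-2$ for all distinct $K,K'\in\mathcal K$; (K3) no singleton is a transversal of $\mathcal K$. Let $\mathcal H=\{H\subseteq V: |H|=k,\ H\not\subseteq K \text{ for all } K\in\mathcal K\}$. Then $\mathcal H$ is a JM hypergraph and a matroid hypergraph.
   Context: A hypergraph $\mathcal H\subseteq 2^V$ is a matroid hypergraph if for all $H,H'\in\mathcal H$ and every $i\in H\setminus H'$ there exists $j\in H'\setminus H$ with $(H\setminus\{i\})\cup\{j\}\in\mathcal H$. The game $NIM_{\mathcal H}$ is played on positions $x\in\mathbb{Z}_{\ge 0}^V$; a move $x\to x'$ chooses $H\in\mathcal H$ and goes to any $x'\in\mathbb Z_{\ge0}^V$ with $x'_i<x_i$ for $i\in H$ and $x'_i=x_i$ for $i\notin H$. Players alternate; the player who cannot move loses. The Sprague–Grundy function is $\mathcal G_{\mathcal H}(x)=\mathrm{mex}\{\mathcal G_{\mathcal H}(x') : x\to x' \text{ a move}\}$ ($\mathrm{mex}(S)$ = least nonnegative integer not in $S$). The height $h_{\mathcal H}(x)$ is the maximum number of consecutive moves possible from $x$. With $e$ the all-ones vector, $m(x)=\min_{i}x_i$, $y_{\mathcal H}(x)=h_{\mathcal H}(x-m(x)e)+1$, $v_{\mathcal H}(x)=\binom{y_{\mathcal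 H}(x)}{2}+\big((m(x)-\binom{y_{\mathcal H}(x)}{2}-1)\bmod y_{\mathcal H}(x)\big)$ (residue in $\{0,\dots,y_{\mathcal H}(x)-1\}$), and $f_{\mathcal H}(x)=h_{\mathcal H}(x)$ if $m(x)\le\binom{y_{\mathcal H}(x)}{2}$, else $f_{\mathcal H}(x)=v_{\mathcal H}(x)$. $\mathcal H$ is JM if $\mathcal G_{\mathcal H}=f_{\mathcal H}$ on $\mathbb Z_{\ge0}^V$. A singleton $\{v\}$ is a transversal of $\mathcal K$ if $v$ belongs to every $K\in\mathcal K$. *)

theory Defs
  imports Main
begin

text \<open>
  A hypergraph on the finite vertex set \<open>V\<close> is a set \<open>\<H>\<close> of subsets of \<open>V\<close>.  Positions are
  total functions on the vertex type; only the coordinates in \<open>V\<close> matter, as a move along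
  \<open>H \<subseteq> V\<close> leaves all other coordinates unchanged.
\<close>

definition matroid_hypergraph :: "'a set set \<Rightarrow> bool" where
  "matroid_hypergraph \<H> \<longleftrightarrow>
     (\<forall>H\<in>\<H>. \<forall>H'\<in>\<H>. \<forall>i\<in>H - H'. \<exists>j\<in>H' - H. (H - {i}) \<union> {j} \<in> \<H>)"

definition nim_move :: "'a set set \<Rightarrow> ('a \<Rightarrow> nat) \<Rightarrow> ('a \<Rightarrow> nat) \<Rightarrow> bool" where
  "nim_move \<H> x x' \<longleftrightarrow> (\<exists>H\<in>\<H>. (\<forall>i\<in>H. x' i < x i) \<and> (\<forall>i. i \<notin> H \<longrightarrow> x' i = x i))"

definition mex :: "nat set \<Rightarrow> nat" where
  "mex S = (LEAST n. n \<notin> S)"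

text \<open>
  Well-founded recursion along moves.  The game terminates as soon as all edges are nonempty
  subsets of a finite set; the defining equation then is \<open>grundy_eq\<close> below.
\<close>

definition grundy :: "'a set set \<Rightarrow> ('a \<Rightarrow> nat) \<Rightarrow> nat" where
  "grundy \<H> = wfrec {(x', x). nim_move \<H> x x'} (\<lambda>g x. mex {g x' |x'. nim_move \<H> x x'})"

definition height :: "'a set set \<Rightarrow> ('a \<Rightarrow> nat) \<Rightarrow> nat" where
  "height \<H> x = Max {l. \<exists>x'. (nim_move \<H> ^^ l) x x'}"

lemma nim_move_sum_less:
  assumes "finite V" "\<And>H. H \<in> \<H> \<Longrightarrow> H \<subseteq> V" "{} \<notin> \<H>" "nim_move \<H> x x'"
  shows "sum x' V < sum x V"
proof -
  obtain H where H: "H \<in> \<H>" "\<forall>i\<in>H. x' i < x i" "\<forall>i. i \<notin> H \<longrightarrow> x' i = x i"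
    using assms(4) unfolding nim_move_def by blast
  obtain i where "i \<in> H" using H(1) assms(3) by fastforce
  moreover have "\<forall>i\<in>V. x' i \<le> x i" using H by (metis less_imp_le_nat order_refl)
  ultimately show ?thesis
    using assms(1,2) H by (intro sum_strict_mono_ex1) blast+
qed

lemma wf_nim_move:
  assumes "finite V" "\<And>H. H \<in> \<H> \<Longrightarrow> H \<subseteq> V" "{} \<notin> \<H>"
  shows "wf {(x', x). nim_move \<H> x x'}"
  by (rule wf_subset[OF wf_measure[of "\<lambda>x. sum x V"]])
     (auto intro: nim_move_sum_less[OF assms])

lemma grundy_eq:
  assumes "finite V" "\<And>H. H \<in> \<H> \<Longrightarrow> H \<subseteq> V" "{} \<notin> \<H>"
  shows "grundy \<H> x = mex {grundy \<H> x' |x'. nim_move \<H> x x'}"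
proof -
  have "grundy \<H> x = mex {cut (grundy \<H>) {(x', x). nim_move \<H> x x'} x x' |x'. nim_move \<H> x x'}"
    by (rule def_wfrec[OF eq_reflection[OF grundy_def] wf_nim_move[OF assms]])
  also have "{cut (grundy \<H>) {(x', x). nim_move \<H> x x'} x x' |x'. nim_move \<H> x x'}
      = {grundy \<H> x' |x'. nim_move \<H> x x'}"
    by (force simp: cut_def)
  finally show ?thesis .
qed

lemma finite_play_lengths:
  assumes "finite V" "\<And>H. H \<in> \<H> \<Longrightarrow> H \<subseteq> V" "{} \<notin> \<H>"
  shows "finite {l. \<exists>x'. (nim_move \<H> ^^ l) x x'}"
proof -
  have "l + sum x' V \<le> sum x V" if "(nim_move \<H> ^^ l) x x'" for l x'
    using that
  proof (induction l arbitrary: x')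
    case (Suc l)
    then obtain z where "(nim_move \<H> ^^ l) x z" "nim_move \<H> z x'" by auto
    with Suc.IH[of z] nim_move_sum_less[OF assms, of z x'] show ?case by simp
  qed auto
  then show ?thesis
    by (intro finite_subset[OF _ finite_atMost[of "sum x V"]]) fastforce
qed

definition min_coord :: "'a set \<Rightarrow> ('a \<Rightarrow> nat) \<Rightarrow> nat" where
  "min_coord V x = Min (x ` V)"

definition y_fun :: "'a set \<Rightarrow> 'a set set \<Rightarrow> ('a \<Rightarrow> nat) \<Rightarrow> nat" where
  "y_fun V \<H> x = height \<H> (\<lambda>i. x i - min_coord V x) + 1"

text \<open>The residue is taken over the integers, since the argument of \<open>mod\<close> may be negative.\<close>

definition v_fun :: "'a set \<Rightarrow> 'a set set \<Rightarrow> ('a \<Rightarrow> nat) \<Rightarrow> nat" where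
  "v_fun V \<H> x = (y_fun V \<H> x choose 2) +
     nat ((int (min_coord V x) - int (y_fun V \<H> x choose 2) - 1) mod int (y_fun V \<H> x))"

definition f_fun :: "'a set \<Rightarrow> 'a set set \<Rightarrow> ('a \<Rightarrow> nat) \<Rightarrow> nat" where
  "f_fun V \<H> x =
     (if min_coord V x \<le> (y_fun V \<H> x choose 2) then height \<H> x else v_fun V \<H> x)"

definition JM_hypergraph :: "'a set \<Rightarrow> 'a set set \<Rightarrow> bool" where
  "JM_hypergraph V \<H> \<longleftrightarrow> (\<forall>x. grundy \<H> x = f_fun V \<H> x)"

end

theory Submission
  imports Defs
begin

text \<open>
  A uniform matroid hypergraph with edges of size at least two is JM as soon as it is minimal
  transversal-free: every edge is disjoint from another one, but every proper subset \<open>U\<close> of \<open>V\<close>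
  containing an edge contains an edge that meets all edges inside \<open>U\<close>.  Lowering one coordinate by
  one lowers the height by at most one, so the heights reached by moves along a fixed edge form an
  interval, and basis exchange links the intervals of different edges.  Hence all heights between
  that of an optimal move and that of emptying a transversal edge are reached, and the formula of
  Jenkyns and Mayberry follows by comparing \<open>m\<close> with the binomial coefficients.

  By K2, if all \<open>k\<close>-sets between \<open>A\<close> and \<open>W\<close> are non-edges, where \<open>A\<close> has fewer than \<open>k\<close>
  elements, then they all lie in the same member of \<open>\<K>\<close>, which therefore contains \<open>W\<close>; this
  yields the exchange property and disjoint edges.  For minimality, take \<open>v\<close> outside \<open>U\<close> and, by
  K3, some \<open>K\<close> avoiding \<open>v\<close>: an edge between \<open>U - K\<close> and \<open>U\<close> leaves only a subset of \<open>K\<close>, and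
  K1 shows that \<open>U - K\<close> itself is an edge when it has \<open>k\<close> elements.
\<close>

section \<open>Mex and triangular numbers\<close>

lemma mex_eqI:
  assumes "\<And>v. v < n \<Longrightarrow> v \<in> S" "n \<notin> S"
  shows "mex S = n"
  unfolding mex_def using assms by (metis (mono_tags, lifting) Least_equality not_less)

definition dec :: "'a set \<Rightarrow> ('a \<Rightarrow> nat) \<Rightarrow> 'a \<Rightarrow> nat" where
  "dec H x = (\<lambda>i. if i \<in> H then x i - 1 else x i)"

definition zero_on :: "'a set \<Rightarrow> ('a \<Rightarrow> nat) \<Rightarrow> 'a \<Rightarrow> nat" where
  "zero_on H x = (\<lambda>i. if i \<in> H then 0 else x i)"

lemma choose_two_Suc: "Suc u choose 2 = (u choose 2) + u"
  by (simp add: numeral_2_eq_2)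

lemma choose_two_mono: "u \<le> w \<Longrightarrow> u choose 2 \<le> w choose 2"
  by (simp add: choose_two mult_le_mono diff_le_mono div_le_mono)

lemma choose_two_gap: "u < w \<Longrightarrow> (u choose 2) + u \<le> w choose 2"
  using choose_two_mono[of "Suc u" w] by (simp add: choose_two_Suc)

text \<open>The blocks of \<open>u\<close> consecutive numbers starting at \<open>u choose 2\<close>
  tile the naturals. When \<open>m\<close> exceeds \<open>y choose 2\<close>, the formula value lies
  in block number \<open>y\<close>, so \<open>y\<close> can be read off from it.\<close>

lemma choose_two_decomposition:
  obtains u r where "v = (u choose 2) + r" "r < u"
proof -
  have "\<exists>u r. v = (u choose 2) + r \<and> r < u"
  proof (induction v)
    case 0
    show ?case by (intro exI[of _ 1] exI[of _ 0]) (simp add: numeral_2_eq_2)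
  next
    case (Suc v)
    then obtain u r where *: "v = (u choose 2) + r" "r < u" by blast
    show ?case
    proof (cases "Suc r < u")
      case True
      then show ?thesis using * by (metis add_Suc_right)
    next
      case False
      then have "Suc v = (Suc u choose 2) + 0" using * by (simp add: choose_two_Suc)
      then show ?thesis by blast
    qed
  qed
  then show thesis using that by blast
qed

lemma choose_two_decomposition_unique:
  assumes "(u choose 2) + r = (w choose 2) + s" "r < u" "s < w"
  shows "u = w"
  using assms choose_two_gap[of u w] choose_two_gap[of w u]
  by (cases u w rule: linorder_cases) auto

section \<open>Height\<close>

locale nim_hypergraph =
  fixes V :: "'a set" and \<H> :: "'a set set"
  assumes finite_V: "finite V"
    and edge_subset: "H \<in> \<H> \<Longrightarrow> H \<subseteq> V"
    and empty_not_edge: "{} \<notin> \<H>"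
begin

lemma finite_lengths: "finite {l. \<exists>x'. (nim_move \<H> ^^ l) x x'}"
  using finite_play_lengths[OF finite_V edge_subset empty_not_edge] .

lemma height_ge: "(nim_move \<H> ^^ l) x x' \<Longrightarrow> l \<le> height \<H> x"
  unfolding height_def using finite_lengths by (intro Max_ge) auto

lemma height_attained: "\<exists>x'. (nim_move \<H> ^^ height \<H> x) x x'"
proof -
  have "(nim_move \<H> ^^ 0) x x" by simp
  then have "{l. \<exists>x'. (nim_move \<H> ^^ l) x x'} \<noteq> {}" by blast
  from Max_in[OF finite_lengths this] show ?thesis unfolding height_def by blast
qed

lemma height_move: "nim_move \<H> x x' \<Longrightarrow> height \<H> x' < height \<H> x"
  using height_attained[of x'] height_ge[of "Suc (height \<H> x')" x]
    relpowp_Suc_I2[of "nim_move \<H>" x x']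
  by (meson Suc_le_lessD)

lemma play_mono:
  "(nim_move \<H> ^^ l) x x' \<Longrightarrow> \<forall>i\<in>V. x i \<le> y i \<Longrightarrow> \<exists>y'. (nim_move \<H> ^^ l) y y'"
proof (induction l arbitrary: x y)
  case 0
  have "(nim_move \<H> ^^ 0) y y" by simp
  then show ?case by blast
next
  case (Suc l)
  from relpowp_Suc_D2[OF Suc.prems(1)] obtain x1
    where x1: "nim_move \<H> x x1" "(nim_move \<H> ^^ l) x1 x'" by blast
  from x1(1) obtain H where H: "H \<in> \<H>" "\<forall>i\<in>H. x1 i < x i" "\<forall>i. i \<notin> H \<longrightarrow> x1 i = x i"
    unfolding nim_move_def by blast
  \<comment> \<open>The larger position copies the move: on \<open>H\<close> it drops to the values
    of \<open>x1\<close>, elsewhere it stays, so it still dominates \<open>x1\<close>.\<close>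
  define y1 where "y1 = (\<lambda>i. if i \<in> H then x1 i else y i)"
  have "nim_move \<H> y y1" unfolding nim_move_def y1_def
    using H Suc.prems(2) edge_subset[OF H(1)] by (intro bexI[of _ H]) force+
  moreover have "\<forall>i\<in>V. x1 i \<le> y1 i" using H Suc.prems(2) by (auto simp: y1_def)
  ultimately show ?case using Suc.IH[OF x1(2)] relpowp_Suc_I2 by meson
qed

lemma height_mono: "\<forall>i\<in>V. x i \<le> y i \<Longrightarrow> height \<H> x \<le> height \<H> y"
  using height_attained[of x] height_ge[of "height \<H> x" y] play_mono[of "height \<H> x" x _ y] by blast

lemma height_cong: "\<forall>i\<in>V. x i = y i \<Longrightarrow> height \<H> x = height \<H> y"
  by (intro antisym height_mono) auto

lemma move_dec: "H \<in> \<H> \<Longrightarrow> \<forall>i\<in>H. 0 < x i \<Longrightarrow> nim_move \<H> x (dec H x)"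
  unfolding nim_move_def dec_def by (intro bexI[of _ H]) auto

lemma move_zero_on: "H \<in> \<H> \<Longrightarrow> \<forall>i\<in>H. 0 < x i \<Longrightarrow> nim_move \<H> x (zero_on H x)"
  unfolding nim_move_def zero_on_def by (intro bexI[of _ H]) auto

text \<open>By monotonicity it is best to lower as little as possible, so an optimal play may start
  by subtracting one along an edge.\<close>

lemma optimal_edge:
  assumes "0 < height \<H> x"
  obtains H where "H \<in> \<H>" "\<forall>i\<in>H. 0 < x i" "height \<H> x = Suc (height \<H> (dec H x))"
proof -
  obtain l where l: "height \<H> x = Suc l" using assms gr0_implies_Suc by blast
  with height_attained[of x] obtain x' where "(nim_move \<H> ^^ Suc l) x x'" by auto
  from relpowp_Suc_D2[OF this] obtain x1
    where x1: "nim_move \<H> x x1" "(nim_move \<H> ^^ l) x1 x'" by blast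
  from x1(1) obtain H where H: "H \<in> \<H>" "\<forall>i\<in>H. x1 i < x i" "\<forall>i. i \<notin> H \<longrightarrow> x1 i = x i"
    unfolding nim_move_def by blast
  have pos: "\<forall>i\<in>H. 0 < x i" using H(2) by fastforce
  have "\<forall>i\<in>V. x1 i \<le> dec H x i" using H by (fastforce simp: dec_def)
  then have "l \<le> height \<H> (dec H x)" using height_ge[OF x1(2)] height_mono by fastforce
  moreover have "height \<H> (dec H x) < height \<H> x" using height_move move_dec[OF H(1) pos] by blast
  ultimately show thesis using that[OF H(1) pos] l by linarith
qed

text \<open>Take an optimal edge \<open>H\<close>. If it contains \<open>j\<close>, the lowered
  position dominates \<open>dec H x\<close>. Otherwise lowering \<open>j\<close> commutes with
  playing \<open>H\<close>, and induction applies.\<close>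

lemma height_unit_step: "height \<H> x \<le> Suc (height \<H> (x(j := x j - 1)))"
proof (induction "height \<H> x" arbitrary: x)
  case (Suc l)
  then obtain H where H: "H \<in> \<H>" "\<forall>i\<in>H. 0 < x i" "height \<H> x = Suc (height \<H> (dec H x))"
    using optimal_edge by (metis zero_less_Suc)
  show ?case
  proof (cases "j \<in> H")
    case True
    then have "height \<H> (dec H x) \<le> height \<H> (x(j := x j - 1))"
      by (intro height_mono) (auto simp: dec_def)
    then show ?thesis using H(3) by simp
  next
    case False
    let ?x = "x(j := x j - 1)"
    have "nim_move \<H> ?x (dec H ?x)" using H False by (intro move_dec) auto
    moreover have "dec H ?x = (dec H x)(j := dec H x j - 1)" using False by (auto simp: dec_def)
    ultimately have "height \<H> ((dec H x)(j := dec H x j - 1)) < height \<H> ?x"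
      using height_move by metis
    moreover have "height \<H> (dec H x) \<le> Suc (height \<H> ((dec H x)(j := dec H x j - 1)))"
      using Suc.hyps H(3) by simp
    ultimately show ?thesis using H(3) by linarith
  qed
qed simp

text \<open>Descend from \<open>b\<close> towards \<open>a\<close> one unit at a time; each step
  loses at most one in height, so no value is skipped.\<close>

lemma height_intermediate:
  assumes "\<forall>i. a i \<le> b i" "height \<H> a \<le> w" "w \<le> height \<H> b"
  shows "\<exists>c. (\<forall>i. a i \<le> c i \<and> c i \<le> b i) \<and> height \<H> c = w"
  using assms
proof (induction "sum b V" arbitrary: b rule: less_induct)
  case less
  show ?case
  proof (cases "height \<H> b = w")
    case True
    then show ?thesis using less.prems by blast
  next
    case False
    then have "\<not> height \<H> b \<le> height \<H> a" using less.prems by linarith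
    then obtain j where j: "j \<in> V" "a j < b j" using height_mono[of b a] by force
    let ?b = "b(j := b j - 1)"
    have "sum ?b V < sum b V" using j finite_V by (intro sum_strict_mono_ex1) auto
    moreover have "\<forall>i. a i \<le> ?b i" using less.prems(1) j by auto
    moreover have "w \<le> height \<H> ?b" using height_unit_step[of b j] less.prems False by linarith
    ultimately obtain c where c: "\<forall>i. a i \<le> c i \<and> c i \<le> ?b i" "height \<H> c = w"
      using less.hyps less.prems(2) by blast
    have "a i \<le> c i \<and> c i \<le> b i" for i
      using c(1)[rule_format, of i] by (auto split: if_splits)
    then show ?thesis using c(2) by blast
  qed
qed

lemma height_ge_edge: "H \<in> \<H> \<Longrightarrow> \<forall>i\<in>H. c \<le> x i \<Longrightarrow> c \<le> height \<H> x"
proof (induction c arbitrary: x)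
  case (Suc c)
  have "c \<le> height \<H> (dec H x)" using Suc by (intro Suc.IH) (auto simp: dec_def)
  moreover have "height \<H> (dec H x) < height \<H> x"
    using Suc.prems by (intro height_move move_dec) auto
  ultimately show ?case by simp
qed simp

text \<open>The set of positive coordinates only shrinks during play, so every edge played contains
  \<open>j\<close> and every move spends a unit of \<open>x j\<close>.\<close>

lemma height_le_common_vertex:
  "\<forall>H\<in>\<H>. (\<forall>i\<in>H. 0 < x i) \<longrightarrow> j \<in> H \<Longrightarrow> height \<H> x \<le> x j"
proof (induction "height \<H> x" arbitrary: x)
  case (Suc l)
  then obtain H where H: "H \<in> \<H>" "\<forall>i\<in>H. 0 < x i" "height \<H> x = Suc (height \<H> (dec H x))"
    using optimal_edge by (metis zero_less_Suc)
  have j: "j \<in> H" using H Suc.prems by blast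
  have "\<And>i. 0 < dec H x i \<Longrightarrow> 0 < x i" by (auto simp: dec_def split: if_splits)
  then have "height \<H> (dec H x) \<le> dec H x j" using Suc H(3) by (intro Suc.hyps(1)) auto
  then show ?case using H(2,3) j by (auto simp: dec_def)
qed simp

lemma height_zero:
  assumes "\<And>H. H \<in> \<H> \<Longrightarrow> \<exists>i\<in>H. x i = 0"
  shows "height \<H> x = 0"
  using optimal_edge[of x] assms by (metis gr0I less_irrefl)

lemma grundy_unique:
  assumes "\<And>x x'. nim_move \<H> x x' \<Longrightarrow> g x' \<noteq> g x"
    and "\<And>x v. v < g x \<Longrightarrow> \<exists>x'. nim_move \<H> x x' \<and> g x' = v"
  shows "grundy \<H> x = g x"
proof (induction x rule: wf_induct[OF wf_nim_move[OF finite_V edge_subset empty_not_edge]])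
  case (2 x)
  then have "grundy \<H> x' = g x'" if "nim_move \<H> x x'" for x' using that by simp
  then have "{grundy \<H> x' |x'. nim_move \<H> x x'} = {g x' |x'. nim_move \<H> x x'}" by metis
  moreover have "mex {g x' |x'. nim_move \<H> x x'} = g x"
    using assms by (intro mex_eqI) fastforce+
  ultimately show ?case by (subst grundy_eq[OF finite_V edge_subset empty_not_edge]) simp_all
qed auto

end

section \<open>Minimal transversal-free matroid hypergraphs\<close>

locale minimal_transversal_free_matroid = nim_hypergraph +
  fixes k :: nat
  assumes uniform: "H \<in> \<H> \<Longrightarrow> card H = k"
    and two_le_k: "2 \<le> k"
    and matroid: "matroid_hypergraph \<H>"
    and nonempty: "\<H> \<noteq> {}"
    and transversal_free: "H \<in> \<H> \<Longrightarrow> \<exists>H'\<in>\<H>. H \<inter> H' = {}"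
    and minimal: "U \<subset> V \<Longrightarrow> \<exists>H\<in>\<H>. H \<subseteq> U \<Longrightarrow>
      \<exists>H\<in>\<H>. H \<subseteq> U \<and> (\<forall>H'\<in>\<H>. H' \<subseteq> U \<longrightarrow> H' \<inter> H \<noteq> {})"
begin

lemma exchange:
  assumes "H \<in> \<H>" "H' \<in> \<H>" "i \<in> H - H'"
  obtains j where "j \<in> H' - H" "insert j (H - {i}) \<in> \<H>"
proof -
  have "\<exists>j\<in>H' - H. (H - {i}) \<union> {j} \<in> \<H>"
    using matroid assms unfolding matroid_hypergraph_def by blast
  then show thesis using that by auto
qed

lemma finite_edge: "H \<in> \<H> \<Longrightarrow> finite H"
  by (rule finite_subset[OF edge_subset finite_V])

text \<open>Minimality is applied to \<open>V - {j}\<close>, which contains an edge because one of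
  two disjoint edges avoids \<open>j\<close>.\<close>

lemma transversal_avoiding:
  assumes "j \<in> V"
  obtains H where "H \<in> \<H>" "j \<notin> H" "\<forall>H'\<in>\<H>. H' \<inter> H = {} \<longrightarrow> j \<in> H'"
proof -
  obtain H0 where H0: "H0 \<in> \<H>" using nonempty by blast
  then obtain H1 where H1: "H1 \<in> \<H>" "H0 \<inter> H1 = {}" using transversal_free by blast
  have "H0 \<subseteq> V - {j} \<or> H1 \<subseteq> V - {j}"
    using H1(2) edge_subset[OF H0] edge_subset[OF H1(1)] by blast
  then have "\<exists>H\<in>\<H>. H \<subseteq> V - {j}" using H0 H1(1) by blast
  moreover have "V - {j} \<subset> V" using assms by blast
  ultimately obtain H where H: "H \<in> \<H>" "H \<subseteq> V - {j}"
    "\<forall>H'\<in>\<H>. H' \<subseteq> V - {j} \<longrightarrow> H' \<inter> H \<noteq> {}"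
    using minimal by meson
  show thesis
  proof (rule that[OF H(1)])
    show "\<forall>H'\<in>\<H>. H' \<inter> H = {} \<longrightarrow> j \<in> H'"
      using H(3) edge_subset by (metis Diff_empty subset_Diff_insert)
  qed (use H(2) in blast)
qed

lemma edge_through:
  assumes "j \<in> V"
  obtains H where "H \<in> \<H>" "j \<in> H"
proof -
  obtain T where T: "T \<in> \<H>" "\<forall>H'\<in>\<H>. H' \<inter> T = {} \<longrightarrow> j \<in> H'"
    using transversal_avoiding[OF assms] by blast
  obtain H where "H \<in> \<H>" "T \<inter> H = {}" using transversal_free[OF T(1)] by blast
  then show thesis using that T(2) by blast
qed

text \<open>Start from an edge through \<open>j\<close> and keep exchanging its elements outside
  \<open>H\<close>, other than \<open>j\<close>, for elements of \<open>H\<close>, until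
  \<open>j\<close> is the only one outside.\<close>

lemma exchange_in:
  assumes "j \<in> V" "H \<in> \<H>" "j \<notin> H"
  obtains i where "i \<in> H" "insert j (H - {i}) \<in> \<H>"
proof -
  have *: "\<exists>i\<in>H. insert j (H - {i}) \<in> \<H>" if "D \<in> \<H>" "j \<in> D" for D
    using that
  proof (induction "card (D - H)" arbitrary: D rule: less_induct)
    case less
    have fin: "finite D" "finite H" using less.prems assms(2) finite_edge by auto
    have card: "card D = card H" using uniform less.prems(1) assms(2) by simp
    show ?case
    proof (cases "D - H = {j}")
      case True
      then have "card (H - D) = 1"
        using card_le_sym_Diff[OF fin] card_le_sym_Diff[OF fin(2,1)] card by simp
      then obtain i where "H - D = {i}" using card_1_singletonE by blast
      then have "i \<in> H" "insert j (H - {i}) = D" using True by auto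
      then show ?thesis using less.prems(1) by metis
    next
      case False
      then obtain i where i: "i \<in> D - H" "i \<noteq> j" using less.prems(2) assms(3) by blast
      then obtain h where h: "h \<in> H - D" "insert h (D - {i}) \<in> \<H>"
        using exchange[OF less.prems(1) assms(2)] by metis
      have "insert h (D - {i}) - H = (D - H) - {i}" using h by auto
      then have "card (insert h (D - {i}) - H) < card (D - H)"
        using i(1) fin(1) by (metis card_Diff1_less finite_Diff)
      then show ?thesis using less.hyps[OF _ h(2)] less.prems(2) i(2) by blast
    qed
  qed
  obtain D where "D \<in> \<H>" "j \<in> D" using edge_through[OF assms(1)] .
  then show thesis using * that by blast
qed

text \<open>Unit decreases along two edges commute, so an edge through \<open>j\<close> that occurs
  later in an optimal play can be moved to the front. If only one move remains, \<open>j\<close> is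
  exchanged into its edge.\<close>

lemma optimal_edge_through:
  assumes "j \<in> V" "\<forall>i\<in>V. 0 < x i"
  shows "\<exists>H\<in>\<H>. j \<in> H \<and> height \<H> x \<le> Suc (height \<H> (dec H x))"
proof -
  \<comment> \<open>Positivity is kept at \<open>j\<close> alone, since the induction passes through
    \<open>dec H x\<close>, which may vanish elsewhere.\<close>
  have "\<exists>H\<in>\<H>. j \<in> H \<and> (\<forall>i\<in>H. 0 < x i) \<and> height \<H> x \<le> Suc (height \<H> (dec H x))"
    if "0 < x j" "0 < height \<H> x" for x
    using that
  proof (induction "height \<H> x" arbitrary: x rule: less_induct)
    case less
    obtain H where H: "H \<in> \<H>" "\<forall>i\<in>H. 0 < x i" "height \<H> x = Suc (height \<H> (dec H x))"
      using optimal_edge less.prems(2) by blast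
    show ?case
    proof (cases "j \<in> H")
      case True
      then show ?thesis using H by auto
    next
      case j: False
      show ?thesis
      proof (cases "height \<H> (dec H x) = 0")
        case True
        obtain i where "i \<in> H" "insert j (H - {i}) \<in> \<H>"
          using exchange_in[OF assms(1) H(1) j] .
        then show ?thesis using H less.prems True by (intro bexI[of _ "insert j (H - {i})"]) auto
      next
        case False
        have "0 < dec H x j" using j less.prems by (simp add: dec_def)
        then obtain H' where H': "H' \<in> \<H>" "j \<in> H'" "\<forall>i\<in>H'. 0 < dec H x i"
          "height \<H> (dec H x) \<le> Suc (height \<H> (dec H' (dec H x)))"
          using less.hyps[of "dec H x"] False H(3) by auto
        have pos: "\<forall>i\<in>H'. 0 < x i" using H'(3) by (auto simp: dec_def split: if_splits)
        have "\<forall>i\<in>H. 0 < dec H' x i" using H(2) H'(3) by (fastforce simp: dec_def)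
        then have "height \<H> (dec H (dec H' x)) < height \<H> (dec H' x)"
          using height_move move_dec[OF H(1)] by blast
        moreover have "dec H (dec H' x) = dec H' (dec H x)" by (auto simp: dec_def)
        ultimately have "height \<H> x \<le> Suc (height \<H> (dec H' x))" using H(3) H'(4) by simp
        then show ?thesis using H' pos by blast
      qed
    qed
  qed
  moreover obtain H where "H \<in> \<H>" using nonempty by blast
  then have "0 < height \<H> x"
    using height_ge_edge[of H 1 x] edge_subset[of H] assms(2) by (force simp: Suc_le_eq)
  ultimately show ?thesis using assms by meson
qed

text \<open>Such a move ends with \<open>m = 0\<close>, where the formula value is the height;
  heights reached this way are therefore formula values reached.\<close>

definition boundary_move :: "('a \<Rightarrow> nat) \<Rightarrow> ('a \<Rightarrow> nat) \<Rightarrow> bool" where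
  "boundary_move x x' \<longleftrightarrow> nim_move \<H> x x' \<and> (\<exists>j\<in>V. x' j = 0)"

text \<open>Both bounds equal \<open>x\<close> off \<open>H\<close> and vanish at \<open>j\<close>,
  so every position between them is the end of a boundary move along \<open>H\<close>.\<close>

lemma boundary_move_between:
  assumes H: "H \<in> \<H>" "\<forall>i\<in>H. b i < x i" "\<forall>i. i \<notin> H \<longrightarrow> b i = x i"
    and b0: "j \<in> V" "b j = 0"
    and w: "height \<H> (zero_on H x) \<le> w" "w \<le> height \<H> b"
  shows "\<exists>x'. boundary_move x x' \<and> height \<H> x' = w"
proof -
  have "\<forall>i. zero_on H x i \<le> b i" using H by (auto simp: zero_on_def)
  from height_intermediate[OF this w] obtain c
    where c: "\<forall>i. zero_on H x i \<le> c i \<and> c i \<le> b i" "height \<H> c = w" by blast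
  have "nim_move \<H> x c" unfolding nim_move_def
  proof (intro bexI[of _ H] conjI ballI allI impI)
    show "c i < x i" if "i \<in> H" for i using that c(1) H(2) by (meson le_less_trans)
    show "c i = x i" if "i \<notin> H" for i
      using that c(1)[rule_format, of i] H(3) by (simp add: zero_on_def)
  qed (rule H(1))
  moreover have "c j = 0" using c(1)[rule_format, of j] b0 by simp
  ultimately show ?thesis using c(2) b0 unfolding boundary_move_def by blast
qed

text \<open>
  Passing from \<open>H\<close> to \<open>H - i + j\<close>, empty the common part and lower \<open>j\<close> by one: this move is
  almost as high as emptying \<open>H\<close>, so no value is skipped.
\<close>

lemma boundary_move_exchange:
  assumes "H \<in> \<H>" "H' \<in> \<H>" "\<forall>i\<in>H. 0 < x i" "\<forall>i\<in>H'. 0 < x i"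
    and "height \<H> (zero_on H' x) \<le> w" "w < height \<H> (zero_on H x)"
  shows "\<exists>x'. boundary_move x x' \<and> height \<H> x' = w"
  using assms(1,3,6)
proof (induction "card (H - H')" arbitrary: H rule: less_induct)
  case less
  have fin: "finite H" "finite H'" using less.prems(1) assms(2) finite_edge by auto
  have card: "card H = card H'" using uniform less.prems(1) assms(2) by simp
  have "H \<noteq> H'" using assms(5) less.prems(3) by auto
  then obtain i where i: "i \<in> H - H'" using card fin by (metis Diff_eq_empty_iff card_subset_eq ex_in_conv)
  then obtain j where j: "j \<in> H' - H" "insert j (H - {i}) \<in> \<H>"
    using exchange[OF less.prems(1) assms(2)] by blast
  let ?H = "insert j (H - {i})"
  have pos: "\<forall>i\<in>?H. 0 < x i" using less.prems(2) assms(4) j by auto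
  show ?case
  proof (cases "w < height \<H> (zero_on ?H x)")
    case True
    have "?H - H' = (H - H') - {i}" using j by auto
    then have "card (?H - H') < card (H - H')"
      using i fin(1) by (metis card_Diff1_less finite_Diff)
    then show ?thesis using less.hyps j(2) pos True by blast
  next
    case False
    let ?c = "zero_on (H - {i}) x"
    let ?b = "?c(j := ?c j - 1)"
    have "height \<H> (zero_on H x) \<le> height \<H> ?c"
      by (intro height_mono) (auto simp: zero_on_def)
    then have w: "w \<le> height \<H> ?b" using height_unit_step[of ?c j] less.prems(3) by linarith
    \<comment> \<open>As \<open>k >= 2\<close>, \<open>?b\<close> empties some vertex of
      \<open>H\<close> other than \<open>i\<close>, so it ends a boundary move along
      \<open>?H\<close>.\<close>
    have "card (H - {i}) \<noteq> 0" using i two_le_k uniform[OF less.prems(1)] fin by simp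
    then obtain l where l: "l \<in> H - {i}" by (metis card.empty all_not_in_conv)
    have "l \<in> V" "?b l = 0"
      using l j(1) edge_subset[OF less.prems(1)] by (auto simp: zero_on_def)
    moreover have "\<forall>i\<in>?H. ?b i < x i" "\<forall>i. i \<notin> ?H \<longrightarrow> ?b i = x i"
      using pos j(1) by (auto simp: zero_on_def)
    ultimately show ?thesis
      using boundary_move_between[OF j(2), of ?b x l w] False w by auto
  qed
qed

text \<open>Down to the height after emptying \<open>B\<close>, moves along \<open>B\<close>
  suffice. Below that, exchanging \<open>B\<close> towards \<open>A\<close> covers the rest, since
  emptying \<open>A\<close> gives at most the height of \<open>a\<close>.\<close>

lemma boundary_move_intermediate:
  assumes "boundary_move x a" "boundary_move x b" "height \<H> a \<le> w" "w \<le> height \<H> b"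
  shows "\<exists>x'. boundary_move x x' \<and> height \<H> x' = w"
proof -
  obtain A where A: "A \<in> \<H>" "\<forall>i\<in>A. a i < x i" "\<forall>i. i \<notin> A \<longrightarrow> a i = x i"
    using assms(1) unfolding boundary_move_def nim_move_def by blast
  obtain B j where B: "B \<in> \<H>" "\<forall>i\<in>B. b i < x i" "\<forall>i. i \<notin> B \<longrightarrow> b i = x i"
    "j \<in> V" "b j = 0"
    using assms(2) unfolding boundary_move_def nim_move_def by blast
  have "height \<H> (zero_on A x) \<le> height \<H> a"
    using A by (intro height_mono) (auto simp: zero_on_def)
  then have "height \<H> (zero_on A x) \<le> w" using assms(3) by linarith
  moreover have pos: "\<forall>i\<in>A. 0 < x i" "\<forall>i\<in>B. 0 < x i" using A(2) B(2) by fastforce+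
  ultimately show ?thesis
    using boundary_move_exchange[OF B(1) A(1) pos(2,1)] boundary_move_between[OF B _ assms(4)]
    by (cases "w < height \<H> (zero_on B x)") auto
qed

text \<open>Empty an edge missing \<open>j\<close> whose disjoint edges all contain
  \<open>j\<close>; afterwards only edges through \<open>j\<close> can be played.\<close>

lemma low_boundary_move:
  assumes "j \<in> V" "\<forall>i\<in>V. 0 < x i"
  shows "\<exists>x'. boundary_move x x' \<and> height \<H> x' \<le> x j"
proof -
  obtain H where H: "H \<in> \<H>" "j \<notin> H" "\<forall>H'\<in>\<H>. H' \<inter> H = {} \<longrightarrow> j \<in> H'"
    using transversal_avoiding[OF assms(1)] .
  obtain l where l: "l \<in> H" using H(1) empty_not_edge by (metis all_not_in_conv)
  have "nim_move \<H> x (zero_on H x)"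
    using assms(2) edge_subset[OF H(1)] by (intro move_zero_on[OF H(1)]) auto
  moreover have "zero_on H x l = 0" "l \<in> V"
    using l edge_subset[OF H(1)] by (auto simp: zero_on_def)
  moreover have "height \<H> (zero_on H x) \<le> zero_on H x j"
  proof (intro height_le_common_vertex ballI impI)
    fix H' assume "H' \<in> \<H>" "\<forall>i\<in>H'. 0 < zero_on H x i"
    then show "j \<in> H'" using H(3) by (fastforce simp: zero_on_def)
  qed
  ultimately show ?thesis using H(2) unfolding boundary_move_def by (auto simp: zero_on_def)
qed

text \<open>The set of positive coordinates is a proper subset of \<open>V\<close>, so minimality
  gives an edge whose emptying ends the game. An optimal move loses only one in height, and all
  heights in between are reached.\<close>

lemma moves_on_boundary:
  assumes j: "j \<in> V" "x j = 0" and w: "w < height \<H> x"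
  shows "\<exists>x'. boundary_move x x' \<and> height \<H> x' = w"
proof -
  have boundary: "boundary_move x x'" if "nim_move \<H> x x'" for x'
    using that j unfolding boundary_move_def nim_move_def by (metis not_less_zero)
  obtain H where H: "H \<in> \<H>" "\<forall>i\<in>H. 0 < x i" "height \<H> x = Suc (height \<H> (dec H x))"
    using optimal_edge[of x] w by auto
  let ?U = "{i\<in>V. 0 < x i}"
  have "j \<notin> ?U" using j by simp
  then have "?U \<subset> V" using j(1) by blast
  moreover have "\<exists>H\<in>\<H>. H \<subseteq> ?U" using H edge_subset by auto
  ultimately obtain T where T: "T \<in> \<H>" "T \<subseteq> ?U" "\<forall>H'\<in>\<H>. H' \<subseteq> ?U \<longrightarrow> H' \<inter> T \<noteq> {}"
    using minimal by meson
  have "height \<H> (zero_on T x) = 0"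
  proof (rule height_zero)
    fix H' assume "H' \<in> \<H>"
    then have "H' \<inter> T \<noteq> {} \<or> (\<exists>i\<in>H'. x i = 0)" using T(3) edge_subset by fastforce
    then show "\<exists>i\<in>H'. zero_on T x i = 0" by (auto simp: zero_on_def)
  qed
  moreover have "nim_move \<H> x (zero_on T x)" using T by (intro move_zero_on) auto
  moreover have "nim_move \<H> x (dec H x)" using H by (intro move_dec) auto
  ultimately show ?thesis
    using boundary boundary_move_intermediate[of x "zero_on T x" "dec H x" w] H(3) w by auto
qed

section \<open>The formula of Jenkyns and Mayberry\<close>

abbreviation m where "m \<equiv> min_coord V"
abbreviation y where "y \<equiv> y_fun V \<H>"
abbreviation f where "f \<equiv> f_fun V \<H>"

lemma V_nonempty: "V \<noteq> {}"
proof
  assume "V = {}"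
  then have "H = {}" if "H \<in> \<H>" for H using edge_subset[OF that] by simp
  then show False using nonempty empty_not_edge by blast
qed

lemma m_le: "i \<in> V \<Longrightarrow> m x \<le> x i"
  unfolding min_coord_def using finite_V by simp

lemma m_attained: "\<exists>j\<in>V. x j = m x"
  unfolding min_coord_def using Min_in[of "x ` V"] finite_V V_nonempty by fastforce

lemma m_eqI: "j \<in> V \<Longrightarrow> x j = c \<Longrightarrow> \<forall>i\<in>V. c \<le> x i \<Longrightarrow> m x = c"
  using m_attained m_le by (metis le_antisym)

lemma m_move: "nim_move \<H> x x' \<Longrightarrow> m x' \<le> m x"
proof -
  assume "nim_move \<H> x x'"
  then have le: "x' i \<le> x i" for i
    unfolding nim_move_def by (metis less_imp_le order_refl)
  obtain j where "j \<in> V" "x j = m x" using m_attained by blast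
  then show "m x' \<le> m x" using le[of j] m_le[of j x'] by simp
qed

lemma y_eq: "y x = Suc (height \<H> (\<lambda>i. x i - m x))"
  unfolding y_fun_def by simp

lemma f_long: "m x \<le> (y x choose 2) \<Longrightarrow> f x = height \<H> x"
  unfolding f_fun_def by simp

lemma f_short:
  assumes "(y x choose 2) < m x"
  shows "f x = (y x choose 2) + (m x - (y x choose 2) - 1) mod y x"
proof -
  \<comment> \<open>The integer difference is nonnegative here, so it agrees with truncated
    subtraction.\<close>
  have "int (m x) - int (y x choose 2) - 1 = int (m x - (y x choose 2) - 1)" using assms by simp
  then have "v_fun V \<H> x = (y x choose 2) + (m x - (y x choose 2) - 1) mod y x"
    unfolding v_fun_def by (metis nat_int zmod_int)
  then show ?thesis using assms unfolding f_fun_def by simp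
qed

lemma f_short_less:
  assumes "(y x choose 2) < m x"
  shows "f x < m x"
proof -
  have "(m x - (y x choose 2) - 1) mod y x \<le> m x - (y x choose 2) - 1" by simp
  then show ?thesis using f_short[OF assms] assms by linarith
qed

lemma f_boundary_move: 
  assumes "boundary_move x x'"
  shows "f x' = height \<H> x'"
proof -
  obtain j where "j \<in> V" "x' j = 0" using assms unfolding boundary_move_def by blast
  then have "m x' = 0" using m_eqI by blast
  then show ?thesis using f_long by simp
qed

section \<open>Every move changes the formula value\<close>

lemma height_shift_after_move:
  assumes "nim_move \<H> x x'"
  shows "m x - c \<le> height \<H> (\<lambda>i. x' i - c)"
proof -
  obtain H where H: "H \<in> \<H>" "\<forall>i. i \<notin> H \<longrightarrow> x' i = x i"
    using assms unfolding nim_move_def by blast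
  \<comment> \<open>An edge untouched by the move keeps coordinates at least \<open>m x\<close>, so
    after subtracting \<open>c\<close> it alone can be played \<open>m x - c\<close> times.\<close>
  obtain H' where H': "H' \<in> \<H>" "H \<inter> H' = {}" using transversal_free[OF H(1)] by blast
  then have "\<forall>i\<in>H'. m x - c \<le> x' i - c"
    using H(2) m_le edge_subset[OF H'(1)] by (metis diff_le_mono disjoint_iff subsetD)
  then show ?thesis by (rule height_ge_edge[OF H'(1)])
qed

lemma f_move_neq:
  assumes "nim_move \<H> x x'"
  shows "f x' \<noteq> f x"
proof -
  have hx': "m x \<le> height \<H> x'" using height_shift_after_move[OF assms, of 0] by simp
  have hx: "height \<H> x' < height \<H> x" using height_move[OF assms] .
  have mm: "m x' \<le> m x" using m_move[OF assms] .
  \<comment> \<open>L stands for \<open>m <= y choose 2\<close>, S for the opposite. In the mixed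
    cases \<open>m x\<close> separates the two values: an S value is below its minimum, and
    \<open>m x <= height \<H> x'\<close>.\<close>
  consider (LL) "m x \<le> y x choose 2" "m x' \<le> y x' choose 2"
    | (LS) "m x \<le> y x choose 2" "y x' choose 2 < m x'"
    | (SL) "y x choose 2 < m x" "m x' \<le> y x' choose 2"
    | (SS) "y x choose 2 < m x" "y x' choose 2 < m x'"
    by linarith
  then show ?thesis
  proof cases
    case LL
    then show ?thesis using f_long hx by simp
  next
    case LS
    then show ?thesis using f_long[of x] f_short_less[of x'] hx hx' mm by simp
  next
    case SL
    then show ?thesis using f_long[of x'] f_short_less[of x] hx' by simp
  next
    case SS
    show ?thesis
    proof
      assume eq: "f x' = f x"
      have "y x > 0" "y x' > 0" by (simp_all add: y_eq)
      then have yy: "y x' = y x"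
        using eq choose_two_decomposition_unique SS f_short by (metis mod_less_divisor)
      show False
      proof (cases "m x' = m x")
        case True
        \<comment> \<open>With the minimum unchanged the move stays legal after subtracting it, so
          \<open>y\<close> would drop.\<close>
        have "nim_move \<H> (\<lambda>i. x i - m x) (\<lambda>i. x' i - m x)"
        proof -
          obtain H where H: "H \<in> \<H>" "\<forall>i\<in>H. x' i < x i" "\<forall>i. i \<notin> H \<longrightarrow> x' i = x i"
            using assms unfolding nim_move_def by blast
          have "\<forall>i\<in>H. m x \<le> x' i" using True m_le edge_subset[OF H(1)] by (metis subsetD)
          then show ?thesis unfolding nim_move_def using H
            by (intro bexI[of _ H]) (auto simp: diff_less_mono)
        qed
        from height_move[OF this] show False using yy True by (simp add: y_eq)
      next
        case False
        let ?c = "y x choose 2"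
        have "(m x - ?c - 1) mod y x = (m x' - ?c - 1) mod y x"
          using eq SS yy f_short by (metis add_left_cancel)
        \<comment> \<open>Equal residues make the drop of the minimum a positive multiple of
          \<open>y x\<close>; the height above the new minimum is then at least \<open>y x\<close>,
          contradicting \<open>y x' = y x\<close>.\<close>
        then have "y x dvd (m x - ?c - 1) - (m x' - ?c - 1)"
          using mm by (intro mod_eq_dvd_iff_nat[THEN iffD1]) auto
        moreover have "(m x - ?c - 1) - (m x' - ?c - 1) = m x - m x'"
          using SS yy mm by simp
        ultimately have "y x \<le> m x - m x'" using False mm by (intro dvd_imp_le) auto
        then have "y x \<le> height \<H> (\<lambda>i. x' i - m x')"
          using height_shift_after_move[OF assms, of "m x'"] by linarith
        then show False using yy by (simp add: y_eq)
      qed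
    qed
  qed
qed

section \<open>Every smaller value is reached\<close>

lemma boundary_move_above_minimum:
  assumes d: "d \<le> m x" "d \<le> w" and w: "w \<le> height \<H> (\<lambda>i. x i - m x)"
    and strict: "d = 0 \<Longrightarrow> w < height \<H> (\<lambda>i. x i - m x)"
  shows "\<exists>z. boundary_move (\<lambda>i. x i - (m x - d)) z \<and> height \<H> z = w"
proof -
  \<comment> \<open>Boundary moves from \<open>?p\<close> correspond to moves from \<open>x\<close>
    that end with minimum \<open>m x - d\<close>.\<close>
  let ?p = "\<lambda>i. x i - (m x - d)"
  obtain j where j: "j \<in> V" "x j = m x" using m_attained by blast
  show ?thesis
  proof (cases "d = 0")
    case True
    then show ?thesis using moves_on_boundary[of j ?p w] j strict by simp
  next
    case False
    have ge: "d \<le> ?p i" if "i \<in> V" for i using m_le[OF that, of x] d(1) by simp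
    then have pos: "\<forall>i\<in>V. 0 < ?p i" using False by fastforce
    have pj: "?p j = d" using j d(1) by simp
    obtain a where a: "boundary_move ?p a" "height \<H> a \<le> d"
      using low_boundary_move[OF j(1) pos] pj by auto
    obtain H where H: "H \<in> \<H>" "j \<in> H" using edge_through[OF j(1)] .
    \<comment> \<open>Since \<open>d >= 1\<close>, lowering the rest of \<open>H\<close> by one and
      emptying \<open>j\<close> still dominates \<open>x\<close> minus its minimum.\<close>
    let ?b = "(dec H ?p)(j := 0)"
    have "nim_move \<H> ?p ?b" unfolding nim_move_def
    proof (intro bexI[of _ H] conjI ballI allI impI)
      show "?b i < ?p i" if "i \<in> H" for i
        using pos that edge_subset[OF H(1)] by (auto simp: dec_def diff_less_mono2)
      show "?b i = ?p i" if "i \<notin> H" for i using that H(2) by (auto simp: dec_def)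
    qed (rule H(1))
    then have "boundary_move ?p ?b" using j(1) unfolding boundary_move_def by auto
    moreover have "height \<H> (\<lambda>i. x i - m x) \<le> height \<H> ?b"
      using j(2) False d(1) by (intro height_mono) (auto simp: dec_def intro!: diff_le_mono2)
    ultimately show ?thesis using boundary_move_intermediate[OF a(1)] a(2) d(2) w by simp
  qed
qed

lemma boundary_move_shift:
  assumes z: "boundary_move (\<lambda>i. x i - c) z" and c: "c \<le> m x"
  obtains x' where "nim_move \<H> x x'" "m x' = c" "y x' = Suc (height \<H> z)"
proof -
  obtain H j where H: "H \<in> \<H>" "\<forall>i\<in>H. z i < x i - c" "\<forall>i. i \<notin> H \<longrightarrow> z i = x i - c"
    and j: "j \<in> V" "z j = 0"
    using z unfolding boundary_move_def nim_move_def by auto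
  define x' where "x' = (\<lambda>i. if i \<in> H then z i + c else x i)"
  have x': "x' i = z i + c" if "i \<in> V" for i
    using that H(3) m_le[OF that, of x] c by (simp add: x'_def)
  have "nim_move \<H> x x'" unfolding nim_move_def x'_def
    using H(1,2) by (intro bexI[of _ H]) (auto simp: less_diff_conv)
  moreover have mx': "m x' = c" using x' j by (intro m_eqI[OF j(1)]) auto
  moreover have "height \<H> (\<lambda>i. x' i - m x') = height \<H> z"
    using x' mx' by (intro height_cong) simp
  ultimately show thesis using that y_eq by simp
qed

lemma f_reaches_below_minimum:
  assumes "v < f x" "v < m x"
  shows "\<exists>x'. nim_move \<H> x x' \<and> f x' = v"
proof -
  obtain u r where v: "v = (u choose 2) + r" and r: "r < u"
    by (rule choose_two_decomposition)
  \<comment> \<open>The target has \<open>y = u\<close> and minimum \<open>m x - d\<close>. This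
    \<open>d\<close> turns the residue in the formula into \<open>r\<close> and keeps the minimum
    above \<open>v\<close>.\<close>
  define d where "d = (m x - v - 1) mod u"
  have du: "d < u" using r by (simp add: d_def)
  have dm: "d \<le> m x - v - 1" by (simp add: d_def)
  \<comment> \<open>For \<open>d = 0\<close> the minimum is kept, so \<open>y\<close> has to fall
    strictly; \<open>u = y x\<close> would then give \<open>f x = v\<close>.\<close>
  have uy: "u < y x \<or> u = y x \<and> d \<noteq> 0"
  proof (cases "m x \<le> y x choose 2")
    case True
    then have "(u choose 2) < (y x choose 2)" using v assms(2) by linarith
    then show ?thesis using choose_two_mono[of "y x" u] by linarith
  next
    case False
    then have fx: "f x = (y x choose 2) + (m x - (y x choose 2) - 1) mod y x"
      using f_short by simp
    have "y x > 0" by (simp add: y_eq)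
    then have "f x < (y x choose 2) + y x" using fx by simp
    then have le: "u \<le> y x" using choose_two_gap[of "y x" u] v assms(1) by linarith
    have "d \<noteq> 0" if "u = y x"
    proof
      assume "d = 0"
      then obtain q where "m x - v - 1 = u * q" unfolding d_def by blast
      then have "m x - (u choose 2) - 1 = u * q + r" using v assms(2) by linarith
      then have "(m x - (u choose 2) - 1) mod u = r" using r by simp
      then show False using fx v assms(1) that by simp
    qed
    then show ?thesis using le by linarith
  qed
  have d: "d \<le> m x" "d \<le> u - 1" using du dm assms(2) by linarith+
  have "u - 1 \<le> height \<H> (\<lambda>i. x i - m x)" "d = 0 \<Longrightarrow> u - 1 < height \<H> (\<lambda>i. x i - m x)"
    using uy r by (auto simp: y_eq)
  then obtain z where z: "boundary_move (\<lambda>i. x i - (m x - d)) z" "height \<H> z = u - 1"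
    using boundary_move_above_minimum[OF d] by blast
  obtain x' where x': "nim_move \<H> x x'" "m x' = m x - d" "y x' = Suc (height \<H> z)"
    using boundary_move_shift[OF z(1)] by auto
  have y': "y x' = u" using x'(3) z(2) r by simp
  have "m x - v - 1 - d = u * ((m x - v - 1) div u)"
    unfolding d_def by (simp add: minus_mod_eq_mult_div)
  then have m': "m x' - (u choose 2) - 1 = u * ((m x - v - 1) div u) + r"
    using x'(2) v dm assms(2) by linarith
  have "(y x' choose 2) < m x'" unfolding y' x'(2) using dm v assms(2) by linarith
  then have "f x' = v" using f_short[of x'] y' m' r v by simp
  then show ?thesis using x'(1) by blast
qed

lemma f_reaches_above_minimum:
  assumes "v < f x" "m x \<le> v"
  shows "\<exists>x'. nim_move \<H> x x' \<and> f x' = v"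
proof -
  have long: "m x \<le> y x choose 2" using assms f_short_less[of x] by linarith
  then have v: "v < height \<H> x" using f_long assms(1) by simp
  obtain j where j: "j \<in> V" "x j = m x" using m_attained by blast
  have boundary: ?thesis if "\<exists>x'. boundary_move x x' \<and> height \<H> x' = v"
    using that f_boundary_move unfolding boundary_move_def by blast
  show ?thesis
  proof (cases "m x = 0")
    case True
    then show ?thesis using boundary moves_on_boundary[OF j(1) _ v] j(2) by simp
  next
    case False
    have pos: "\<forall>i\<in>V. 0 < x i" using False m_le by (metis gr0I le_zero_eq)
    obtain H where H: "H \<in> \<H>" "j \<in> H" "height \<H> x \<le> Suc (height \<H> (dec H x))"
      using optimal_edge_through[OF j(1) pos] by blast
    let ?b = "dec H x"
    let ?a = "?b(j := 0)"
    have posH: "\<forall>i\<in>H. 0 < x i" using pos edge_subset[OF H(1)] by blast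
    have move: "nim_move \<H> x c" if "\<forall>i. ?a i \<le> c i \<and> c i \<le> ?b i" for c
      unfolding nim_move_def
    proof (intro bexI[of _ H] conjI ballI allI impI)
      show "c i < x i" if "i \<in> H" for i
        using that \<open>\<forall>i. ?a i \<le> c i \<and> c i \<le> ?b i\<close>[rule_format, of i] posH
        by (fastforce simp: dec_def)
      show "c i = x i" if "i \<notin> H" for i
        using that \<open>\<forall>i. ?a i \<le> c i \<and> c i \<le> ?b i\<close>[rule_format, of i] H(2)
        by (auto simp: dec_def split: if_splits)
    qed (rule H(1))
    show ?thesis
    proof (cases "height \<H> ?a \<le> v")
      case True
      have "\<forall>i. ?a i \<le> ?b i" by simp
      from height_intermediate[OF this True] obtain c
        where c: "\<forall>i. ?a i \<le> c i \<and> c i \<le> ?b i" "height \<H> c = v" using H(3) v by force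
      \<comment> \<open>Only \<open>j\<close> varies between \<open>?a\<close> and
        \<open>?b\<close>. The minimum falls by at least one and every other coordinate by at most
        one, so \<open>y\<close> does not drop and the value is still the height.\<close>
      have cj: "c j < m x" using c(1)[rule_format, of j] H(2) j(2) False by (simp add: dec_def)
      have ci: "x i - 1 \<le> c i" if "i \<noteq> j" for i
        using c(1)[rule_format, of i] that by (auto simp: dec_def split: if_splits)
      have "c j \<le> c i" if "i \<in> V" for i
        using ci[of i] m_le[OF that, of x] cj by (cases "i = j") auto
      then have mc: "m c = c j" using m_eqI[OF j(1)] by blast
      have "x i - m x \<le> c i - m c" for i
        using ci[of i] j(2) cj mc by (cases "i = j") auto
      then have "y x \<le> y c" unfolding y_eq using height_mono by simp
      then have "m c \<le> y c choose 2" using choose_two_mono[of "y x" "y c"] long cj mc by linarith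
      then show ?thesis using f_long move[OF c(1)] c(2) by blast
    next
      case False
      \<comment> \<open>Now \<open>v\<close> lies between the heights of a low boundary move and of
        the boundary move to \<open>?a\<close>.\<close>
      have "nim_move \<H> x ?a" by (rule move) simp
      then have "boundary_move x ?a" using j(1) unfolding boundary_move_def by auto
      moreover obtain l where "boundary_move x l" "height \<H> l \<le> m x"
        using low_boundary_move[OF j(1) pos] j(2) by auto
      ultimately show ?thesis
        using boundary boundary_move_intermediate[of x l ?a v] False assms(2) by simp
    qed
  qed
qed

theorem JM: "JM_hypergraph V \<H>"
  unfolding JM_hypergraph_def
proof (intro allI grundy_unique)
  fix x v assume "v < f x"
  then show "\<exists>x'. nim_move \<H> x x' \<and> f x' = v"
    using f_reaches_below_minimum f_reaches_above_minimum by (meson not_less)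
qed (rule f_move_neq)

end

section \<open>Sets avoiding a sparse family\<close>

text \<open>Two \<open>k\<close>-sets that differ by one swap share \<open>k - 1\<close> elements,
  so members of \<K> containing them coincide. Swapping elements of \<open>H - A\<close> for
  elements of \<open>W\<close> keeps the same \<open>K\<close>.\<close>

lemma sparse_family_covers:
  fixes \<K> :: "'a set set"
  assumes sparse: "\<forall>K\<in>\<K>. \<forall>K'\<in>\<K>. K \<noteq> K' \<longrightarrow> card (K \<inter> K') \<le> k - 2"
    and fin: "\<And>K. K \<in> \<K> \<Longrightarrow> finite K" "finite W"
    and k: "2 \<le> k" and AW: "A \<subseteq> W" "card A < k" "k \<le> card W"
    and cov: "\<And>H. A \<subseteq> H \<Longrightarrow> H \<subseteq> W \<Longrightarrow> card H = k \<Longrightarrow> \<exists>K\<in>\<K>. H \<subseteq> K"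
  shows "\<exists>K\<in>\<K>. W \<subseteq> K"
proof -
  obtain H where H: "A \<subseteq> H" "H \<subseteq> W" "card H = k"
    using exists_subset_between[of A k W] AW fin(2) by auto
  obtain K where K: "K \<in> \<K>" "H \<subseteq> K" using cov[OF H] by blast
  have finH: "finite H" using H(2) fin(2) finite_subset by blast
  have "w \<in> K" if w: "w \<in> W" for w
  proof (cases "w \<in> H")
    case False
    obtain a where a: "a \<in> H" "a \<notin> A" using H AW(2) by (metis less_irrefl subsetI subset_antisym)
    have "card (insert w (H - {a})) = k"
      using False a(1) H(3) finH by (metis card_Suc_Diff1 card_insert_disjoint finite_Diff DiffD1)
    then obtain K' where K': "K' \<in> \<K>" "insert w (H - {a}) \<subseteq> K'"
      using cov[of "insert w (H - {a})"] H a w by blast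
    have "card (H - {a}) \<le> card (K \<inter> K')" using K K' fin(1) by (intro card_mono) auto
    moreover have "card (H - {a}) = k - 1" using a(1) H(3) finH by simp
    ultimately have "K = K'" using sparse[rule_format, OF K(1) K'(1)] k by fastforce
    then show ?thesis using K' by blast
  qed (use K in blast)
  then show ?thesis using K(1) by blast
qed

section \<open>The hypergraph of \<open>k\<close>-sets contained in no member of \<K>\<close>

theorem theorem5p8:
  fixes \<delta> k n :: nat and V :: "nat set" and \<K> \<H> :: "nat set set"
  assumes "0 < \<delta>" and "\<delta> + 3 \<le> k"
    and "n = 2 * k + \<delta>" and "V = {1..n}"
    and "\<K> \<subseteq> Pow V" and "\<forall>K\<in>\<K>. card K = k + \<delta> - 1"
    and K1: "\<forall>K\<in>\<K>. \<forall>K'\<in>\<K>. \<delta> \<le> card (K \<inter> K')"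
    and K2: "\<forall>K\<in>\<K>. \<forall>K'\<in>\<K>. K \<noteq> K' \<longrightarrow> card (K \<inter> K') \<le> k - 2"
    and K3: "\<not> (\<exists>v\<in>V. \<forall>K\<in>\<K>. v \<in> K)"
    and "\<H> = {H. H \<subseteq> V \<and> card H = k \<and> (\<forall>K\<in>\<K>. \<not> H \<subseteq> K)}"
  shows "JM_hypergraph V \<H> \<and> matroid_hypergraph \<H>"
proof -
  have finV: "finite V" and cardV: "card V = 2 * k + \<delta>" using assms(3,4) by auto
  have finK: "finite K" if "K \<in> \<K>" for K using that assms(5) by (intro finite_subset[OF _ finV]) blast
  have edge: "H \<in> \<H> \<longleftrightarrow> H \<subseteq> V \<and> card H = k \<and> (\<forall>K\<in>\<K>. \<not> H \<subseteq> K)" for H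
    using assms(10) by simp
  have fin: "finite H" if "H \<in> \<H>" for H using that edge by (intro finite_subset[OF _ finV]) simp
  have between: "\<exists>H\<in>\<H>. A \<subseteq> H \<and> H \<subseteq> W"
    if "A \<subseteq> W" "W \<subseteq> V" "card A < k" "k \<le> card W" "\<forall>K\<in>\<K>. \<not> W \<subseteq> K" for A W
  proof (rule ccontr)
    assume none: "\<not> ?thesis"
    have "\<exists>K\<in>\<K>. H \<subseteq> K" if H: "A \<subseteq> H" "H \<subseteq> W" "card H = k" for H
    proof -
      have "H \<notin> \<H>" using none H(1,2) by blast
      then show ?thesis using edge[of H] H(3) subset_trans[OF H(2) \<open>W \<subseteq> V\<close>] by blast
    qed
    moreover have "finite W" by (rule finite_subset[OF that(2) finV])
    moreover have "2 \<le> k" using assms(2) by simp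
    ultimately have "\<exists>K\<in>\<K>. W \<subseteq> K"
      by (intro sparse_family_covers[OF K2 finK _ _ that(1,3,4)])
    then show False using that(5) by blast
  qed
  have large: "\<forall>K\<in>\<K>. \<not> W \<subseteq> K" if "k + \<delta> \<le> card W" for W
  proof (intro ballI notI)
    fix K assume K: "K \<in> \<K>" "W \<subseteq> K"
    then have "card W \<le> k + \<delta> - 1" using card_mono[OF finK[OF K(1)] K(2)] assms(6) by simp
    then show False using that assms(1) by linarith
  qed

  have matroid: "matroid_hypergraph \<H>" unfolding matroid_hypergraph_def
  proof (intro ballI)
    fix H H' i assume H: "H \<in> \<H>" "H' \<in> \<H>" and i: "i \<in> H - H'"
    let ?A = "H - {i}" and ?W = "(H - {i}) \<union> H'"
    have card: "card H = k" "card H' = k" using H edge by auto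
    have A: "card ?A = k - 1" using i card by simp
    have "k \<le> card ?W" using card_mono[of ?W H'] fin[OF H(1)] fin[OF H(2)] card by auto
    moreover have "\<forall>K\<in>\<K>. \<not> ?W \<subseteq> K" using edge[of H'] H(2) by blast
    moreover have "?W \<subseteq> V" using edge[of H] edge[of H'] H by blast
    \<comment> \<open>The upper set contains the edge \<open>H'\<close>, so it lies in no member of
      \<K>; \<open>B\<close> adds one element to \<open>?A\<close>, and it is not \<open>i\<close>
      because \<open>i\<close> is outside \<open>H'\<close>.\<close>
    ultimately obtain B where B: "B \<in> \<H>" "?A \<subseteq> B" "B \<subseteq> ?W"
      using between[of ?A ?W] A assms(2) by auto
    have "card (B - ?A) = k - (k - 1)"
      using A B(2) edge[of B] B(1) fin[OF H(1)] by (simp add: card_Diff_subset)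
    then have "card (B - ?A) = 1" using assms(2) by simp
    then obtain j where j: "B - ?A = {j}" using card_1_singletonE by blast
    then have "?A \<union> {j} = B" "j \<in> H' - H" using B i by auto
    then show "\<exists>j\<in>H' - H. H - {i} \<union> {j} \<in> \<H>" using B(1) by metis
  qed

  have minimal: "\<exists>H\<in>\<H>. H \<subseteq> U \<and> (\<forall>H'\<in>\<H>. H' \<subseteq> U \<longrightarrow> H' \<inter> H \<noteq> {})"
    if U: "U \<subset> V" and ex: "\<exists>H\<in>\<H>. H \<subseteq> U" for U
  proof -
    have finU: "finite U" by (rule finite_subset[OF psubset_imp_subset[OF U] finV])
    show ?thesis
    proof (cases "card U < 2 * k")
      \<comment> \<open>There is no room for two disjoint edges in \<open>U\<close>, so any edge
        inside \<open>U\<close> will do.\<close>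
      case True
      obtain H where H: "H \<in> \<H>" "H \<subseteq> U" using ex by blast
      have "H' \<inter> H \<noteq> {}" if "H' \<in> \<H>" "H' \<subseteq> U" for H'
      proof
        assume "H' \<inter> H = {}"
        then have "card (H' \<union> H) = 2 * k"
          using card_Un_disjoint[OF fin[OF that(1)] fin[OF H(1)]] edge[of H] edge[of H'] H(1) that(1) by simp
        moreover have "card (H' \<union> H) \<le> card U" using H(2) that(2) finU by (intro card_mono) auto
        ultimately show False using True by linarith
      qed
      then show ?thesis using H by blast
    next
      case False
      obtain v where v: "v \<in> V" "v \<notin> U" using U by blast
      then obtain K where K: "K \<in> \<K>" "v \<notin> K" using K3 by blast
      \<comment> \<open>The complement of \<open>K\<close> has
        \<open>2k + \<delta> - (k + \<delta> - 1)\<close> elements, one of which is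
        \<open>v\<close>.\<close>
      have "card (V - K) = k + 1"
        using K(1) assms(2,5,6) cardV finK by (subst card_Diff_subset) auto
      moreover have "U - K \<subseteq> (V - K) - {v}" using v U by blast
      ultimately have le: "card (U - K) \<le> k"
        using card_mono[of "(V - K) - {v}" "U - K"] v(1) K(2) finV by simp
      have "\<exists>H\<in>\<H>. U - K \<subseteq> H \<and> H \<subseteq> U"
      proof (cases "card (U - K) < k")
        case True
        have "\<forall>K\<in>\<K>. \<not> U \<subseteq> K" using False assms(2) by (intro large) simp
        then show ?thesis using between[of "U - K" U] True False U by auto
      next
        case eq: False
        \<comment> \<open>Otherwise \<open>K'\<close> would contain these \<open>k\<close> elements
          besides its at least \<delta> common elements with \<open>K\<close>, one more than its
          size allows.\<close>
        have "\<not> U - K \<subseteq> K'" if K': "K' \<in> \<K>" for K'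
        proof
          assume "U - K \<subseteq> K'"
          then have "card ((K \<inter> K') \<union> (U - K)) \<le> card K'" using finK[OF K'] by (intro card_mono) auto
          moreover have "card ((K \<inter> K') \<union> (U - K)) = card (K \<inter> K') + card (U - K)"
            using finK[OF K'] finU by (intro card_Un_disjoint) auto
          moreover have "\<delta> \<le> card (K \<inter> K')" using K1 K(1) K' by blast
          ultimately show False using eq K' assms(1,6) by auto
        qed
        then have "U - K \<in> \<H>" using edge[of "U - K"] eq le U by auto
        then show ?thesis by blast
      qed
      then obtain H where H: "H \<in> \<H>" "U - K \<subseteq> H" "H \<subseteq> U" by blast
      \<comment> \<open>An edge inside \<open>U\<close> and disjoint from \<open>H\<close> would lie
        in \<open>K\<close>.\<close>
      have "H' \<inter> H \<noteq> {}" if "H' \<in> \<H>" "H' \<subseteq> U" for H'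
        using edge[of H'] that H(2) K(1) by blast
      then show ?thesis using H by blast
    qed
  qed

  interpret minimal_transversal_free_matroid V \<H> k
  proof
    show "{} \<notin> \<H>" "2 \<le> k" using edge[of "{}"] assms(2) by auto
    show "\<H> \<noteq> {}" using between[of "{}" V] large[of V] cardV assms(2) by auto
    show "\<exists>H'\<in>\<H>. H \<inter> H' = {}" if "H \<in> \<H>" for H
    proof -
      \<comment> \<open>The complement of an edge is larger than every member of \<K>, so it
        contains an edge.\<close>
      have "card (V - H) = k + \<delta>" using that edge[of H] fin[OF that] cardV by (simp add: card_Diff_subset)
      then obtain H' where "H' \<in> \<H>" "H' \<subseteq> V - H"
        using between[of "{}" "V - H"] large[of "V - H"] assms(2) by auto
      then show ?thesis by blast
    qed
    show "H \<subseteq> V" "card H = k" if "H \<in> \<H>" for H using edge[of H] that by blast+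
  qed (fact finV matroid minimal)+
  show ?thesis using JM matroid by blast
qed

end
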